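(* Let $\mu$ be a positive measure on $\mathbb{D}$. Then $\mu$ is a $\mathcal{D}$-Carleson measure if and only if $K_1:L^2(\mathbb{D})\to L^2(\mathbb{D},\mu)$ is bounded, where $$K_1f(z)=\int_{\mathbb{D}}\frac{f(w)}{1-z\bar w}\,dA(w).$$
   Context: $\mathbb{D}$ is the open unit disk in $\mathbb{C}$, $dA$ is the Lebesgue area measure, and $L^2(\mathbb{D})=L^2(\mathbb{D},dA)$. The Dirichlet space $\mathcal{D}$ consists of the analytic functions $f$ on $\mathbb{D}$ with $\|f\|_{\mathcal{D}}^2=|f(0)|^2+\frac1\pi\int_{\mathbb{D}}|f'(z)|^2\,dA(z)<\infty$. A positive measure $\mu$ on $\mathbb{D}$ is a $\mathcal{D}$-Carleson measure if there is a constant $C$ such that $\int_{\mathbb{D}}|f|^2\,d\mu\le C\|f\|_{\mathcal{D}}^2$ for all $f\in\mathcal{D}$. *)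

theory Defs
  imports "HOL-Complex_Analysis.Complex_Analysis"
begin

abbreviation disk :: "complex set" where
  "disk \<equiv> ball 0 1"

text \<open>Elements of \<open>L\<^sup>2\<close> are represented by functions rather than by classes modulo null sets;
  only their values on \<^term>\<open>space M\<close> matter.\<close>

definition L2_space :: "'a measure \<Rightarrow> ('a \<Rightarrow> complex) set" where
  "L2_space M = {f \<in> borel_measurable M. integrable M (\<lambda>x. (cmod (f x))\<^sup>2)}"

definition L2_norm :: "'a measure \<Rightarrow> ('a \<Rightarrow> complex) \<Rightarrow> real" where
  "L2_norm M f = sqrt (\<integral>x. (cmod (f x))\<^sup>2 \<partial>M)"

text \<open>Linearity is required up to null sets. Together with the norm bound it makes \<open>T\<close> compatible
  with almost-everywhere equality, so that \<open>T\<close> acts on the classes.\<close>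

definition bounded_L2_operator ::
    "'a measure \<Rightarrow> 'b measure \<Rightarrow> (('a \<Rightarrow> complex) \<Rightarrow> 'b \<Rightarrow> complex) \<Rightarrow> bool" where
  "bounded_L2_operator M N T \<longleftrightarrow>
     (\<forall>f\<in>L2_space M. T f \<in> L2_space N) \<and>
     (\<forall>f\<in>L2_space M. \<forall>g\<in>L2_space M. AE z in N. T (\<lambda>w. f w + g w) z = T f z + T g z) \<and>
     (\<forall>f\<in>L2_space M. \<forall>c. AE z in N. T (\<lambda>w. c * f w) z = c * T f z) \<and>
     (\<exists>C\<ge>0. \<forall>f\<in>L2_space M. L2_norm N (T f) \<le> C * L2_norm M f)"

definition dirichlet_space :: "(complex \<Rightarrow> complex) set" where
  "dirichlet_space =
     {f. f holomorphic_on disk \<and> integrable (lebesgue_on disk) (\<lambda>z. (cmod (deriv f z))\<^sup>2)}"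

definition dirichlet_norm :: "(complex \<Rightarrow> complex) \<Rightarrow> real" where
  "dirichlet_norm f =
     sqrt ((cmod (f 0))\<^sup>2 + (1 / pi) * (\<integral>z. (cmod (deriv f z))\<^sup>2 \<partial>lebesgue_on disk))"

text \<open>The left-hand integral is taken in \<^typ>\<open>ennreal\<close>, so that the inequality includes the
  finiteness of that integral.\<close>

definition dirichlet_carleson :: "complex measure \<Rightarrow> bool" where
  "dirichlet_carleson \<mu> \<longleftrightarrow>
     (\<exists>C::real\<ge>0. \<forall>f\<in>dirichlet_space.
        (\<integral>\<^sup>+z. ennreal ((cmod (f z))\<^sup>2) \<partial>\<mu>) \<le> ennreal (C * (dirichlet_norm f)\<^sup>2))"

definition K1 :: "(complex \<Rightarrow> complex) \<Rightarrow> complex \<Rightarrow> complex" where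
  "K1 f z = (\<integral>w. f w / (1 - z * cnj w) \<partial>lebesgue_on disk)"

end

theory Submission
  imports Defs
begin

text \<open>Expanding the kernel gives \<open>K\<^sub>1 f(z) = (\<Sum>n. a\<^sub>n z\<^sup>n)\<close> with \<open>a\<^sub>n\<close> the inner product of \<open>f\<close> and \<open>w\<^sup>n\<close>
  over the disk. The monomials are orthogonal with squared norms \<open>\<pi> / (n + 1)\<close>, so Bessel's inequality
  bounds \<open>(\<Sum>n. (n + 1) \<bar>a\<^sub>n\<bar>\<^sup>2)\<close>, which is comparable to the squared Dirichlet norm of \<open>K\<^sub>1 f\<close>, by the squared
  \<open>L\<^sup>2\<close> norm of \<open>f\<close>. Conversely every \<open>g\<close> in the Dirichlet space equals \<open>K\<^sub>1 f\<close> for \<open>f = (z g)' / \<pi>\<close>,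
  whose \<open>L\<^sup>2\<close> norm is bounded by the Dirichlet norm of \<open>g\<close>. Hence both conditions on \<open>\<mu>\<close> express the
  same estimate.\<close>

subsection \<open>Invariance of Lebesgue measure\<close>

lemma nn_integral_lborel_translate:
  fixes g :: "'a::euclidean_space \<Rightarrow> ennreal"
  assumes [measurable]: "g \<in> borel_measurable borel"
  shows "(\<integral>\<^sup>+x. g (a + x) \<partial>lborel) = (\<integral>\<^sup>+x. g x \<partial>lborel)"
  by (subst (2) lborel_distr_plus[of a, symmetric]) (simp add: nn_integral_distr)

text \<open>Average \<open>g \<circ> f\<close> over translates by points of the unit ball and exchange the two integrals:
  only the invariance of the ball under \<open>f\<close> and translation invariance are needed.\<close>

lemma nn_integral_lborel_orthogonal:
  fixes f :: "'a::euclidean_space \<Rightarrow> 'a"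
  assumes f: "orthogonal_transformation f" and [measurable]: "g \<in> borel_measurable borel"
  shows "(\<integral>\<^sup>+x. g (f x) \<partial>lborel) = (\<integral>\<^sup>+x. g x \<partial>lborel)"
proof -
  have lin: "linear f" using f by (rule orthogonal_transformation_linear)
  have [measurable]: "f \<in> borel_measurable borel"
    by (intro borel_measurable_continuous_onI linear_continuous_on linear_conv_bounded_linear[THEN iffD1] lin)
  let ?B = "indicator (ball 0 1) :: 'a \<Rightarrow> ennreal"
  have Bm [measurable]: "?B \<in> borel_measurable borel"
    by (intro borel_measurable_indicator borel_open open_ball)
  define b where "b = (\<integral>\<^sup>+x. ?B x \<partial>lborel)"
  have b: "b = ennreal (measure lborel (ball (0::'a) 1))"
    using emeasure_lborel_ball_finite[of "0::'a" 1]
    by (simp add: b_def emeasure_eq_ennreal_measure less_top[symmetric])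
  \<comment> \<open>The volume of the unit ball is positive and finite, so it can be cancelled at
    the end.\<close>
  have b0: "b \<noteq> 0" "b \<noteq> \<infinity>" 
    using content_ball_gt_0_iff[of "0::'a" 1] by (simp_all add: b del: content_ball_gt_0_iff)
  \<comment> \<open>Writing \<open>x = f x'\<close>, the isometry turns
    \<open>norm (x - f y)\<close> into \<open>norm (x' - y)\<close>, and the integral is the volume
    of the unit ball about \<open>x'\<close>.\<close>
  have Binv: "(\<integral>\<^sup>+y. ?B (x - f y) \<partial>lborel) = b" for x
  proof -
    obtain x' where x': "x = f x'" using orthogonal_transformation_surj[OF f] by (metis surj_def)
    have "norm (x - f y) = norm (- x' + y)" for y
      using orthogonal_transformation_norm[OF f, of "x' - y"] lin
      by (simp add: x' linear_diff norm_minus_commute)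
    then have "?B (x - f y) = ?B (- x' + y)" for y
      by (simp add: indicator_def)
    then show ?thesis using nn_integral_lborel_translate[OF Bm, of "-x'"]
      by (simp add: b_def)
  qed
  have surj: "\<exists>y. x = f y" for x using orthogonal_transformation_surj[OF f] by (metis surj_def)
  have "b * (\<integral>\<^sup>+x. g (f x) \<partial>lborel) = (\<integral>\<^sup>+x. (\<integral>\<^sup>+y. ?B x * g (f y) \<partial>lborel) \<partial>lborel)"
    unfolding b_def by (subst nn_integral_cmult, measurable, subst nn_integral_multc) (auto simp: Bm)
  \<comment> \<open>With \<open>x = f x'\<close>, translating \<open>y\<close> by \<open>x'\<close>
    changes \<open>f y\<close> into \<open>x + f y\<close> by linearity.\<close>
  also have "\<dots> = (\<integral>\<^sup>+x. (\<integral>\<^sup>+y. ?B x * g (x + f y) \<partial>lborel) \<partial>lborel)"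
  proof (rule nn_integral_cong)
    fix x :: 'a
    obtain x' where x': "x = f x'" using surj by blast
    show "(\<integral>\<^sup>+y. ?B x * g (f y) \<partial>lborel) = (\<integral>\<^sup>+y. ?B x * g (x + f y) \<partial>lborel)"
      using nn_integral_lborel_translate[of "\<lambda>y. ?B x * g (f y)" x'] lin
      by (simp add: x' linear_add)
  qed
  also have "\<dots> = (\<integral>\<^sup>+y. (\<integral>\<^sup>+x. ?B x * g (x + f y) \<partial>lborel) \<partial>lborel)"
    by (rule lborel_pair.Fubini') measurable
  \<comment> \<open>Translating \<open>x\<close> by \<open>f y\<close> moves the shift from
    \<open>g\<close> onto the ball, so that \<open>Binv\<close> evaluates the integral over
    \<open>y\<close>.\<close>
  also have "\<dots> = (\<integral>\<^sup>+y. (\<integral>\<^sup>+x. ?B (x - f y) * g x \<partial>lborel) \<partial>lborel)"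
  proof (rule nn_integral_cong)
    fix y :: 'a
    show "(\<integral>\<^sup>+x. ?B x * g (x + f y) \<partial>lborel) = (\<integral>\<^sup>+x. ?B (x - f y) * g x \<partial>lborel)"
      using nn_integral_lborel_translate[of "\<lambda>x. ?B (x - f y) * g x" "f y"] by (simp add: add.commute)
  qed
  also have "\<dots> = (\<integral>\<^sup>+x. (\<integral>\<^sup>+y. ?B (x - f y) * g x \<partial>lborel) \<partial>lborel)"
    by (rule lborel_pair.Fubini') measurable
  also have "\<dots> = b * (\<integral>\<^sup>+x. g x \<partial>lborel)"
    by (subst nn_integral_multc, measurable) (simp add: Binv nn_integral_cmult)
  finally show ?thesis using b0 by (simp add: ennreal_mult_cancel_left)
qed

text \<open>The nonnegative version, applied to indicators, shows that \<open>f\<close> pushes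
  \<open>lborel\<close> forward to itself; this carries over to Bochner integrals of all Borel
  functions, integrable or not.\<close>

lemma integral_lborel_orthogonal:
  fixes f :: "'a::euclidean_space \<Rightarrow> 'a" and g :: "'a \<Rightarrow> 'b::{banach, second_countable_topology}"
  assumes f: "orthogonal_transformation f" and [measurable]: "g \<in> borel_measurable borel"
  shows "(\<integral>x. g (f x) \<partial>lborel) = (\<integral>x. g x \<partial>lborel)"
proof -
  have [measurable]: "f \<in> borel_measurable borel"
    by (intro borel_measurable_continuous_onI linear_continuous_on linear_conv_bounded_linear[THEN iffD1]
        orthogonal_transformation_linear f)
  have "distr lborel borel f = lborel"
  proof (rule measure_eqI)
    fix A assume "A \<in> sets (distr lborel borel f)"
    then have [measurable]: "A \<in> sets borel" by simp
    have "emeasure (distr lborel borel f) A = (\<integral>\<^sup>+x. indicator A x \<partial>distr lborel borel f)"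
      by simp
    also have "\<dots> = (\<integral>\<^sup>+x. indicator A (f x) \<partial>lborel)"
      by (rule nn_integral_distr) auto
    also have "\<dots> = emeasure lborel A"
      by (subst nn_integral_lborel_orthogonal[OF f]) auto
    finally show "emeasure (distr lborel borel f) A = emeasure lborel A" .
  qed simp
  then show ?thesis
    using integral_distr[of f lborel borel g] by simp
qed

lemma integral_lborel_scale:
  fixes g :: "'a::euclidean_space \<Rightarrow> 'b::{banach, second_countable_topology}"
  assumes [measurable]: "g \<in> borel_measurable borel" and c: "c \<noteq> 0"
  shows "(\<integral>x. g x \<partial>lborel) = \<bar>c\<bar> ^ DIM('a) *\<^sub>R (\<integral>x. g (c *\<^sub>R x) \<partial>lborel)"
  by (subst lborel_affine[OF c, of 0]) (simp add: integral_density integral_distr)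

subsection \<open>Moments of the disk\<close>

lemma borel_measurable_indicator_ball_cnj [measurable]:
  "(\<lambda>w::complex. indicator (ball 0 r) w *\<^sub>R (w ^ m * cnj w ^ n)) \<in> borel_measurable borel"
  by (intro borel_measurable_scaleR borel_measurable_indicator borel_measurable_continuous_onI continuous_intros) auto

lemma of_real_norm_power_even: "complex_of_real (cmod w ^ (2 * n)) = w ^ n * cnj w ^ n"
  by (metis complex_norm_square of_real_power power_mult power_mult_distrib)

text \<open>Rotation invariance: replacing \<open>w\<close> by \<open>u * w\<close> multiplies the
  integrand by \<open>u ^ m * cnj u ^ n\<close>, and a rotation for which this factor differs from 1
  forces the integral to vanish.\<close>

lemma moment_orthogonal:
  assumes "m \<noteq> n"
  shows "(\<integral>w. indicator (ball 0 r) w *\<^sub>R (w ^ m * cnj w ^ n) \<partial>lborel) = 0" (is "?I = 0")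
proof -
  \<comment> \<open>The angle makes the factor equal to \<open>cis pi\<close>, that is -1.\<close>
  define t where "t = pi / (real m - real n)"
  define u where "u = cis t"
  have ot: "orthogonal_transformation ((*) u)"
  proof (rule orthogonal_transformation[THEN iffD2], intro conjI allI)
    show "linear ((*) u)" by (rule bounded_linear.linear[OF bounded_linear_mult_right])
    show "norm (u * v) = norm v" for v by (simp add: norm_mult u_def)
  qed
  have "?I = (\<integral>w. indicator (ball 0 r) (u * w) *\<^sub>R ((u * w) ^ m * cnj (u * w) ^ n) \<partial>lborel)"
    by (rule integral_lborel_orthogonal[OF ot borel_measurable_indicator_ball_cnj, symmetric])
  also have "\<dots> = (\<integral>w. (u ^ m * cnj u ^ n) * (indicator (ball 0 r) w *\<^sub>R (w ^ m * cnj w ^ n)) \<partial>lborel)"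
    by (intro Bochner_Integration.integral_cong)
       (auto simp: indicator_def norm_mult u_def power_mult_distrib)
  also have "\<dots> = (u ^ m * cnj u ^ n) * ?I" by (rule integral_mult_right_zero)
  finally have *: "?I = (u ^ m * cnj u ^ n) * ?I" .
  have "u ^ m * cnj u ^ n = cis ((real m - real n) * t)"
    by (simp add: u_def Complex.DeMoivre cis_cnj cis_mult algebra_simps)
  also have "\<dots> = - 1" using assms by (simp add: t_def)
  finally have "?I = - ?I" using * by simp
  then show ?thesis by simp
qed

text \<open>Homogeneity: the exponent adds the degree \<open>m + n\<close> of the integrand and the
  real dimension 2 from the Jacobian.\<close>

lemma moment_scale:
  assumes "0 < r"
  shows "(\<integral>w. indicator (ball 0 r) w *\<^sub>R (w ^ m * cnj w ^ n) \<partial>lborel)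
     = of_real r ^ (m + n + 2) * (\<integral>w. indicator (ball 0 1) w *\<^sub>R (w ^ m * cnj w ^ n) \<partial>lborel)"
proof -
  have "(\<integral>w. indicator (ball 0 r) w *\<^sub>R (w ^ m * cnj w ^ n) \<partial>lborel)
     = r\<^sup>2 *\<^sub>R (\<integral>w. indicator (ball 0 r) (r *\<^sub>R w) *\<^sub>R ((r *\<^sub>R w) ^ m * cnj (r *\<^sub>R w) ^ n) \<partial>lborel)"
    using assms by (subst integral_lborel_scale[where c=r]) (simp_all add: power_mult_distrib)
  also have "(\<integral>w. indicator (ball 0 r) (r *\<^sub>R w) *\<^sub>R ((r *\<^sub>R w) ^ m * cnj (r *\<^sub>R w) ^ n) \<partial>lborel)
     = (\<integral>w. of_real r ^ (m + n) * (indicator (ball 0 1) w *\<^sub>R (w ^ m * cnj w ^ n)) \<partial>lborel)"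
    using assms by (intro Bochner_Integration.integral_cong)
       (auto simp: indicator_def scaleR_conv_of_real power_mult_distrib power_add norm_mult)
  also have "\<dots> = of_real r ^ (m + n) * (\<integral>w. indicator (ball 0 1) w *\<^sub>R (w ^ m * cnj w ^ n) \<partial>lborel)"
    by (rule integral_mult_right_zero)
  finally show ?thesis by (simp add: scaleR_conv_of_real power_add power2_eq_square)
qed

lemma integrable_ball_norm_power:
  "integrable lborel (\<lambda>w. indicator (ball (0::complex) r) w *\<^sub>R cmod w ^ n)"
proof (rule Bochner_Integration.integrable_bound)
  show "integrable lborel (\<lambda>w. indicator (ball (0::complex) r) w *\<^sub>R \<bar>r\<bar> ^ n)"
    using emeasure_lborel_ball_finite[of "0::complex" r] by (intro integrable_scaleR_left) (simp add: integrable_indicator_iff)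
  show "(\<lambda>w. indicator (ball (0::complex) r) w *\<^sub>R cmod w ^ n) \<in> borel_measurable lborel"
    by (intro borel_measurable_scaleR borel_measurable_indicator) auto
qed (auto simp: indicator_def intro!: power_mono)

lemma integral_ball_const:
  fixes c :: real
  assumes "0 \<le> r"
  shows "(\<integral>w. indicator (ball (0::complex) r) w *\<^sub>R c \<partial>lborel) = (pi * r\<^sup>2) * c"
  using assms content_ball[of r "0::complex"] emeasure_lborel_ball_finite[of "0::complex" r] unit_ball_vol_2
  by (subst integral_scaleR_left) (simp_all add: integrable_indicator_iff)

text \<open>Comparing the integral over the annulus \<open>s \<le> \<bar>w\<bar> < 1\<close> with its area and letting \<open>s\<close> tend to
  \<open>1\<close> replaces polar coordinates.\<close>

lemma norm_moment_unit:
  "(\<integral>w. indicator (ball (0::complex) 1) w *\<^sub>R cmod w ^ (2 * n) \<partial>lborel) = pi / (n + 1)"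
proof -
  let ?J = "\<lambda>r. (\<integral>w. indicator (ball (0::complex) r) w *\<^sub>R cmod w ^ (2 * n) \<partial>lborel)"
  let ?A = "\<lambda>r. (\<integral>w. indicator (ball (0::complex) r) w *\<^sub>R (1::real) \<partial>lborel)"
  \<comment> \<open>Identifies the real integral with a diagonal complex moment, to which
    \<open>moment_scale\<close> applies.\<close>
  have J: "of_real (?J r) = (\<integral>w. indicator (ball 0 r) w *\<^sub>R (w ^ n * cnj w ^ n) \<partial>lborel)" for r
    unfolding integral_complex_of_real[symmetric]
    by (intro Bochner_Integration.integral_cong)
       (auto simp: indicator_def of_real_norm_power_even simp del: of_real_power)
  have scale: "?J r = r ^ (2 * n + 2) * ?J 1" if "0 < r" for r
    using moment_scale[OF that, of n n] unfolding J[symmetric]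
    by (simp add: mult_2[symmetric] of_real_power[symmetric] of_real_mult[symmetric] del: of_real_power of_real_mult)
  have int: "integrable lborel (\<lambda>w. indicator (ball (0::complex) r) w *\<^sub>R cmod w ^ k)" for r k
    by (rule integrable_ball_norm_power)
  have int1: "integrable lborel (\<lambda>w::complex. indicator (ball 0 r) w *\<^sub>R (c::real))" for r c
    using integrable_scaleR_left[of c lborel "indicator (ball (0::complex) r)"]
      emeasure_lborel_ball_finite[of "0::complex" r] by (simp add: integrable_indicator_iff)
  \<comment> \<open>Here \<open>u\<close> is the square of the inner radius. On the annulus the
    integrand lies between \<open>u ^ n\<close> and 1, and the area is \<open>pi * (1 - u)\<close>;
    cancelling \<open>1 - u\<close> leaves the geometric sum, which is continuous at
    \<open>u = 1\<close>.\<close>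
  have bounds: "pi * u ^ n \<le> ?J 1 * (\<Sum>k<Suc n. u ^ k) \<and> ?J 1 * (\<Sum>k<Suc n. u ^ k) \<le> pi"
    if u: "0 < u" "u < 1" for u :: real
  proof -
    define s where "s = sqrt u"
    have s: "0 < s" "s < 1" and su: "s\<^sup>2 = u" using u by (auto simp: s_def)
    have "s ^ (2 * n + 2) = u ^ Suc n"
      unfolding su[symmetric] power_mult[symmetric] by simp
    then have "?J 1 - ?J s = (1 - u ^ Suc n) * ?J 1"
      using scale[OF s(1)] by (simp add: algebra_simps)
    then have diff: "?J 1 - ?J s = (1 - u) * (?J 1 * (\<Sum>k<Suc n. u ^ k))"
      unfolding one_diff_power_eq by (simp only: mult_ac)
    have ind: "indicator (ball (0::complex) 1) w - indicator (ball 0 s) w = (if s \<le> cmod w \<and> cmod w < 1 then 1 else 0 :: real)" for w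
      using s by (auto simp: indicator_def)
    have eqJ: "?J 1 - ?J s = (\<integral>w. (if s \<le> cmod w \<and> cmod w < 1 then cmod w ^ (2 * n) else 0) \<partial>lborel)"
      unfolding Bochner_Integration.integral_diff[OF int int, symmetric] scaleR_diff_left[symmetric] ind
      by (intro Bochner_Integration.integral_cong) auto
    have eqA: "pi * (1 - u) * c = (\<integral>w. (if s \<le> cmod w \<and> cmod w < 1 then c else 0) \<partial>lborel)" for c
    proof -
      have "pi * (1 - u) * c = (\<integral>w. indicator (ball (0::complex) 1) w *\<^sub>R c \<partial>lborel) - (\<integral>w. indicator (ball (0::complex) s) w *\<^sub>R c \<partial>lborel)"
        using s su integral_ball_const[of 1 c] integral_ball_const[of s c] by (auto simp: algebra_simps)
      also have "\<dots> = (\<integral>w. indicator (ball 0 1) w *\<^sub>R c - indicator (ball (0::complex) s) w *\<^sub>R c \<partial>lborel)"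
        by (rule Bochner_Integration.integral_diff[OF int1 int1, symmetric])
      also have "\<dots> = (\<integral>w. (if s \<le> cmod w \<and> cmod w < 1 then c else 0) \<partial>lborel)"
        using s by (intro Bochner_Integration.integral_cong) (auto simp: indicator_def)
      finally show ?thesis .
    qed
    have iJ: "integrable lborel (\<lambda>w::complex. (if s \<le> cmod w \<and> cmod w < 1 then cmod w ^ (2 * n) else 0))"
      by (rule Bochner_Integration.integrable_cong[THEN iffD1, OF refl _ Bochner_Integration.integrable_diff[OF int[of 1 "2*n"] int[of s "2*n"]]])
         (simp add: scaleR_diff_left[symmetric] ind del: real_scaleR_def)
    have iA: "integrable lborel (\<lambda>w::complex. (if s \<le> cmod w \<and> cmod w < 1 then c else 0))" for c :: real
      by (rule Bochner_Integration.integrable_cong[THEN iffD1, OF refl _ Bochner_Integration.integrable_diff[OF int1[of 1 c] int1[of s c]]])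
         (simp add: scaleR_diff_left[symmetric] ind del: real_scaleR_def)
    have "s ^ (2 * n) = u ^ n" using su by (simp add: power_mult)
    then have "pi * (1 - u) * u ^ n \<le> ?J 1 - ?J s"
      unfolding eqA eqJ using s
      by (intro integral_mono iA iJ) (auto intro: power_mono simp flip: \<open>s ^ (2 * n) = u ^ n\<close>)
    moreover have "?J 1 - ?J s \<le> pi * (1 - u) * 1"
      unfolding eqA eqJ using s by (intro integral_mono iA iJ) (auto intro: power_le_one)
    ultimately show ?thesis using u unfolding diff
      by (auto simp: mult.assoc mult.left_commute[of pi] mult_le_cancel_left)
  qed
  have ev: "eventually (\<lambda>u::real. 0 < u \<and> u < 1) (at_left 1)"
    using eventually_at_left_real[of 0 1] by (auto elim: eventually_mono)
  have "((\<lambda>u::real. pi * u ^ n) \<longlongrightarrow> pi * 1 ^ n) (at_left 1)"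
    "((\<lambda>u::real. ?J 1 * (\<Sum>k<Suc n. u ^ k)) \<longlongrightarrow> ?J 1 * (\<Sum>k<Suc n. 1 ^ k)) (at_left 1)"
    by (intro tendsto_intros)+
  note lim = this
  \<comment> \<open>At \<open>u = 1\<close> both bounds equal \<open>pi\<close>, and the sum has
    \<open>n + 1\<close> terms equal to 1.\<close>
  have "pi * 1 ^ n \<le> ?J 1 * (\<Sum>k<Suc n. 1 ^ k)"
    by (rule tendsto_le[OF _ lim(2) lim(1)]) (use ev bounds in \<open>auto elim!: eventually_mono\<close>)
  moreover have "?J 1 * (\<Sum>k<Suc n. 1 ^ k) \<le> pi"
    by (rule tendsto_upperbound[OF lim(2)]) (use ev bounds in \<open>auto elim!: eventually_mono\<close>)
  ultimately have "?J 1 * (real n + 1) = pi" by (simp add: add.commute)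
  then show ?thesis by (simp add: field_simps)
qed

lemma moment_ball:
  assumes "0 < r"
  shows "(\<integral>w. indicator (ball 0 r) w *\<^sub>R (w ^ m * cnj w ^ n) \<partial>lborel)
     = (if m = n then of_real (pi * r ^ (2 * n + 2) / (n + 1)) else 0)"
proof (cases "m = n")
  case True
  have "(\<integral>w. indicator (ball 0 1) w *\<^sub>R (w ^ n * cnj w ^ n) \<partial>lborel)
    = (\<integral>w. of_real (indicator (ball (0::complex) 1) w *\<^sub>R cmod w ^ (2 * n)) \<partial>lborel)"
    by (intro Bochner_Integration.integral_cong)
       (auto simp: indicator_def of_real_norm_power_even simp del: of_real_power)
  also have "\<dots> = of_real (pi / (n + 1))"
    unfolding integral_complex_of_real norm_moment_unit ..
  finally show ?thesis using moment_scale[OF assms, of n n] True by (simp add: mult_2)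
qed (simp add: moment_orthogonal)

subsection \<open>Power series in the Bergman space\<close>

lemma integrable_mult_bounded:
  fixes f g :: "'a \<Rightarrow> complex"
  assumes "integrable M f" and [measurable]: "g \<in> borel_measurable M" and "\<And>x. x \<in> space M \<Longrightarrow> cmod (g x) \<le> B"
  shows "integrable M (\<lambda>x. f x * g x)"
proof (rule Bochner_Integration.integrable_bound)
  show "integrable M (\<lambda>x. of_real B * f x)" using assms(1) by (rule integrable_mult_right)
  show "(\<lambda>x. f x * g x) \<in> borel_measurable M" using assms(1) by measurable
  show "AE x in M. cmod (f x * g x) \<le> cmod (of_real B * f x)"
    using assms(3) by (intro AE_I2) (force simp: norm_mult mult.commute[of _ "cmod (f _)"] intro!: mult_left_mono)
qed

text \<open>Used with \<open>t = n + 1\<close>, where a weighted coefficient meets the squared norm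
  of a monomial.\<close>

lemma power2_mult_divide: "(t * x)\<^sup>2 / t = t * x\<^sup>2" for t :: real
  by (simp add: power2_eq_square)

lemma L2_norm_power2: "(L2_norm M f)\<^sup>2 = (\<integral>x. (cmod (f x))\<^sup>2 \<partial>M)"
  unfolding L2_norm_def by (intro real_sqrt_pow2 integral_nonneg_AE) auto

lemma L2_norm_nonneg: "0 \<le> L2_norm M f"
  unfolding L2_norm_def by (intro real_sqrt_ge_zero integral_nonneg_AE) auto

text \<open>Constants are integrable for a finite measure, so
  \<open>1 + (cmod (f x))\<^sup>2\<close> is an integrable majorant.\<close>

lemma (in finite_measure) L2_space_imp_integrable:
  assumes "f \<in> L2_space M"
  shows "integrable M f"
proof (rule Bochner_Integration.integrable_bound)
  show "integrable M (\<lambda>x. 1 + (cmod (f x))\<^sup>2)" using assms by (simp add: L2_space_def)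
  have "t \<le> 1 + t\<^sup>2" for t :: real
    using zero_le_power2[of "t - 1/2"] by (simp add: power2_eq_square algebra_simps)
  then show "AE x in M. cmod (f x) \<le> norm (1 + (cmod (f x))\<^sup>2)"
    by (intro AE_I2) (auto simp: abs_of_nonneg)
qed (use assms in \<open>simp add: L2_space_def\<close>)

text \<open>Converts a finite \<open>ennreal\<close> bound, the form delivered by Fatou's lemma and
  by the Carleson condition, into membership and a real norm estimate.\<close>

lemma L2_spaceI_nn_integral:
  assumes [measurable]: "f \<in> borel_measurable M" and le: "(\<integral>\<^sup>+x. ennreal ((cmod (f x))\<^sup>2) \<partial>M) \<le> ennreal B" and "0 \<le> B"
  shows "f \<in> L2_space M" "(L2_norm M f)\<^sup>2 \<le> B"
proof -
  have int: "integrable M (\<lambda>x. (cmod (f x))\<^sup>2)"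
    using le by (intro integrableI_bounded) (auto simp: le_less_trans)
  then show "f \<in> L2_space M" by (simp add: L2_space_def)
  show "(L2_norm M f)\<^sup>2 \<le> B"
    unfolding L2_norm_power2 using le assms(3) nn_integral_eq_integral[OF int] by simp
qed

lemma nn_integral_L2_norm:
  assumes "f \<in> L2_space M"
  shows "(\<integral>\<^sup>+x. ennreal ((cmod (f x))\<^sup>2) \<partial>M) = ennreal ((L2_norm M f)\<^sup>2)"
  unfolding L2_norm_power2 using assms by (intro nn_integral_eq_integral) (auto simp: L2_space_def)

section \<open>Monomials, polynomials and power series on the disk\<close>

interpretation disk: finite_measure "lebesgue_on disk"
  by (intro finite_measure_lebesgue_on lmeasurable_ball)

lemma borel_measurable_disk_continuous:
  "continuous_on disk f \<Longrightarrow> f \<in> borel_measurable (lebesgue_on disk)"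
  by (rule continuous_imp_measurable_on_sets_lebesgue) auto

lemma borel_measurable_disk_indicator_ball [measurable]:
  "indicator (ball z r) \<in> borel_measurable (lebesgue_on disk)"
  by (intro measurable_restrict_space1 borel_measurable_indicator) auto

text \<open>The antiholomorphic factor is estimated by 1 only: in the series to be dominated,
  \<open>m\<close> varies and \<open>n\<close> is fixed.\<close>

lemma norm_monomial_le:
  assumes "cmod w \<le> r" "r \<le> 1"
  shows "cmod (w ^ m * cnj w ^ n) \<le> r ^ m"
proof -
  have "0 \<le> r" using assms(1) norm_ge_zero order_trans by blast
  then have "cmod w ^ m * cmod w ^ n \<le> r ^ m * 1"
    using assms by (intro mult_mono power_mono power_le_one) auto
  then show ?thesis by (simp add: norm_mult norm_power)
qed

lemma integrable_monomial: "integrable (lebesgue_on disk) (\<lambda>w. w ^ m * cnj w ^ n)"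
  by (rule disk.integrable_const_bound[where B=1])
     (auto intro!: norm_monomial_le[where r=1, simplified] borel_measurable_disk_continuous continuous_intros)

lemma integrable_mult_cnj_power:
  "integrable (lebesgue_on disk) f \<Longrightarrow> integrable (lebesgue_on disk) (\<lambda>w. f w * cnj w ^ n)"
  by (rule integrable_mult_bounded[where B=1])
     (auto intro!: borel_measurable_disk_continuous continuous_intros power_le_one simp: norm_power)

text \<open>Radii below 1 are included because a power series on the disk is integrated term by term
  over smaller balls first.\<close>

lemma moment_ball_disk:
  assumes "0 < r" "r \<le> 1"
  shows "(\<integral>w. indicator (ball 0 r) w *\<^sub>R (w ^ m * cnj w ^ n) \<partial>lebesgue_on disk)
     = (if m = n then of_real (pi * r ^ (2 * n + 2) / (n + 1)) else 0)"
proof -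
  have "(\<integral>w. indicator (ball 0 r) w *\<^sub>R (w ^ m * cnj w ^ n) \<partial>lebesgue_on disk)
     = (\<integral>w. indicator disk w *\<^sub>R indicator (ball 0 r) w *\<^sub>R (w ^ m * cnj w ^ n) \<partial>lebesgue)"
    by (rule integral_restrict_space) auto
  also have "\<dots> = (\<integral>w. indicator (ball 0 r) w *\<^sub>R (w ^ m * cnj w ^ n) \<partial>lebesgue)"
    using assms by (intro Bochner_Integration.integral_cong) (auto simp: indicator_def)
  also have "\<dots> = (\<integral>w. indicator (ball 0 r) w *\<^sub>R (w ^ m * cnj w ^ n) \<partial>lborel)"
    by (rule integral_completion) simp
  finally show ?thesis using moment_ball[OF assms(1)] by simp
qed

lemma moment_disk:
  "(\<integral>w. w ^ m * cnj w ^ n \<partial>lebesgue_on disk) = (if m = n then of_real (pi / (n + 1)) else 0)"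
proof -
  have "(\<integral>w. w ^ m * cnj w ^ n \<partial>lebesgue_on disk)
     = (\<integral>w. indicator disk w *\<^sub>R (w ^ m * cnj w ^ n) \<partial>lebesgue_on disk)"
    by (rule Bochner_Integration.integral_cong) auto
  then show ?thesis using moment_ball_disk[of 1 m n] by simp
qed

text \<open>Parseval for finite sums: the squared modulus expands into a double sum of moments, of
  which only the diagonal survives.\<close>

lemma polynomial_L2:
  shows polynomial_in_L2_space: "(\<lambda>w. \<Sum>n<N. b n * w ^ n) \<in> L2_space (lebesgue_on disk)"
    and polynomial_L2_norm: "(L2_norm (lebesgue_on disk) (\<lambda>w. \<Sum>n<N. b n * w ^ n))\<^sup>2
      = pi * (\<Sum>n<N. (cmod (b n))\<^sup>2 / real (n + 1))"
proof -
  let ?M = "lebesgue_on disk"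
  have eq: "complex_of_real ((cmod (\<Sum>n<N. b n * w ^ n))\<^sup>2)
      = (\<Sum>m<N. \<Sum>n<N. (b m * cnj (b n)) * (w ^ m * cnj w ^ n))" for w
    by (simp add: complex_norm_square sum_product mult_ac del: of_real_power)
  have int: "integrable ?M (\<lambda>w. complex_of_real ((cmod (\<Sum>n<N. b n * w ^ n))\<^sup>2))"
    unfolding eq by (intro Bochner_Integration.integrable_sum integrable_mult_right integrable_monomial)
  then have int': "integrable ?M (\<lambda>w. (cmod (\<Sum>n<N. b n * w ^ n))\<^sup>2)"
    by (simp only: complex_of_real_integrable_eq)
  show "(\<lambda>w. \<Sum>n<N. b n * w ^ n) \<in> L2_space ?M"
    using int' by (auto simp: L2_space_def intro!: borel_measurable_disk_continuous continuous_intros)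
  have "complex_of_real (\<integral>w. (cmod (\<Sum>n<N. b n * w ^ n))\<^sup>2 \<partial>?M)
      = (\<Sum>m<N. \<Sum>n<N. (b m * cnj (b n)) * (\<integral>w. w ^ m * cnj w ^ n \<partial>?M))"
    unfolding integral_complex_of_real[symmetric] eq
    by (subst Bochner_Integration.integral_sum, intro Bochner_Integration.integrable_sum integrable_mult_right integrable_monomial)+
       (simp add: integrable_monomial)
  also have "\<dots> = (\<Sum>m<N. b m * cnj (b m) * of_real (pi / (m + 1)))"
    unfolding moment_disk by (intro sum.cong refl) (simp add: if_distrib cong: if_cong)
  also have "\<dots> = of_real (pi * (\<Sum>n<N. (cmod (b n))\<^sup>2 / real (n + 1)))"
    unfolding of_real_mult of_real_sum sum_distrib_left
    by (intro sum.cong refl) (simp add: complex_norm_square[symmetric] del: of_real_power)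
  finally show "(L2_norm ?M (\<lambda>w. \<Sum>n<N. b n * w ^ n))\<^sup>2 = pi * (\<Sum>n<N. (cmod (b n))\<^sup>2 / real (n + 1))"
    unfolding L2_norm_power2 of_real_eq_iff .
qed

lemma bessel_monomials:
  assumes f: "f \<in> L2_space (lebesgue_on disk)"
  shows "(\<Sum>n<N. real (n + 1) * (cmod (\<integral>w. f w * cnj w ^ n \<partial>lebesgue_on disk))\<^sup>2)
    \<le> pi * (L2_norm (lebesgue_on disk) f)\<^sup>2"
proof -
  let ?M = "lebesgue_on disk"
  define a where "a n = (\<integral>w. f w * cnj w ^ n \<partial>?M)" for n
  define S where "S = (\<Sum>n<N. real (n + 1) * (cmod (a n))\<^sup>2)"
  \<comment> \<open>Up to the factor \<open>pi\<close>, this is the orthogonal projection of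
    \<open>f\<close> onto the span of the first \<open>N\<close> monomials. Hence \<open>S\<close>
    is its inner product with \<open>f\<close>, and \<open>pi * S\<close> is its squared
    norm.\<close>
  define p where "p w = (\<Sum>n<N. (of_nat (n + 1) * a n) * w ^ n)" for w
  have intf: "integrable ?M f" using disk.L2_space_imp_integrable[OF f] .
  have p: "p \<in> L2_space ?M" "(L2_norm ?M p)\<^sup>2 = pi * S"
  proof -
    show "p \<in> L2_space ?M" unfolding p_def by (rule polynomial_in_L2_space)
    have "(cmod (of_nat (n + 1) * a n))\<^sup>2 / real (n + 1) = real (n + 1) * (cmod (a n))\<^sup>2" for n
    proof -
      have *: "cmod (of_nat (n + 1) * a n) = real (n + 1) * cmod (a n)"
        unfolding norm_mult norm_of_nat ..
      show ?thesis unfolding * by (rule power2_mult_divide)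
    qed
    then show "(L2_norm ?M p)\<^sup>2 = pi * S" unfolding p_def S_def polynomial_L2_norm by (simp only:)
  qed
  have eq: "f w * cnj (p w) = (\<Sum>n<N. cnj (of_nat (n + 1) * a n) * (f w * cnj w ^ n))" for w
    by (simp add: p_def sum_distrib_left mult_ac)
  have int: "integrable ?M (\<lambda>w. f w * cnj (p w))"
    unfolding eq by (intro Bochner_Integration.integrable_sum integrable_mult_right integrable_mult_cnj_power intf)
  have "(\<integral>w. f w * cnj (p w) \<partial>?M) = (\<Sum>n<N. cnj (of_nat (n + 1) * a n) * a n)"
    unfolding eq
    by (subst Bochner_Integration.integral_sum, intro integrable_mult_right integrable_mult_cnj_power intf)
       (simp only: integral_mult_right_zero a_def)
  also have "\<dots> = of_real S"
    unfolding S_def of_real_sum of_real_mult complex_norm_square by (intro sum.cong) auto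
  finally have fp: "(\<integral>w. f w * cnj (p w) \<partial>?M) = of_real S" .
  have intf2: "integrable ?M (\<lambda>w. (cmod (f w))\<^sup>2)" and intp2: "integrable ?M (\<lambda>w. (cmod (p w))\<^sup>2)"
    using f p(1) by (auto simp: L2_space_def)
  have "2 * S = (\<integral>w. 2 * Re (f w * cnj (p w)) \<partial>?M)"
    using fp int by (simp add: integral_Re del: times_complex.sel)
  \<comment> \<open>Young's inequality, weighted by \<open>pi\<close> so that the term in
    \<open>p\<close> integrates to exactly \<open>S\<close>; one of the two copies of
    \<open>S\<close> then cancels.\<close>
  also have "\<dots> \<le> (\<integral>w. pi * (cmod (f w))\<^sup>2 + (cmod (p w))\<^sup>2 / pi \<partial>?M)"
  proof (intro integral_mono Bochner_Integration.integrable_add integrable_mult_right integrable_Re int intf2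
      integrable_divide intp2)
    fix w
    have "2 * Re (f w * cnj (p w)) \<le> 2 * (cmod (f w) * cmod (p w))"
      using complex_Re_le_cmod[of "f w * cnj (p w)"] by (simp add: norm_mult del: times_complex.sel)
    also have "\<dots> \<le> pi * (cmod (f w))\<^sup>2 + (cmod (p w))\<^sup>2 / pi"
      using zero_le_power2[of "pi * cmod (f w) - cmod (p w)"]
      by (simp add: field_simps power2_eq_square)
    finally show "2 * Re (f w * cnj (p w)) \<le> pi * (cmod (f w))\<^sup>2 + (cmod (p w))\<^sup>2 / pi" .
  qed
  also have "\<dots> = pi * (L2_norm ?M f)\<^sup>2 + S"
    using intf2 intp2 p(2) by (simp add: L2_norm_power2)
  finally show ?thesis unfolding S_def a_def by linarith
qed

text \<open>Fatou's lemma for the partial sums, whose norms are known from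
  \<open>polynomial_L2\<close>.\<close>

lemma power_series_L2:
  assumes sums: "\<And>w. w \<in> disk \<Longrightarrow> (\<lambda>n. c n * w ^ n) sums h w"
    and le: "\<And>N. (\<Sum>n<N. (cmod (c n))\<^sup>2 / real (n + 1)) \<le> B"
  shows power_series_in_L2_space: "h \<in> L2_space (lebesgue_on disk)"
    and power_series_L2_norm: "(L2_norm (lebesgue_on disk) h)\<^sup>2 \<le> pi * B"
proof -
  let ?M = "lebesgue_on disk"
  define s where "s N w = (\<Sum>n<N. c n * w ^ n)" for N w
  have "h holomorphic_on disk" using sums by (intro power_series_holomorphic[where a=c]) auto
  then have h: "h \<in> borel_measurable ?M"
    by (intro borel_measurable_disk_continuous holomorphic_on_imp_continuous_on)
  have s: "s N \<in> L2_space ?M" "(L2_norm ?M (s N))\<^sup>2 \<le> pi * B" for N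
    using polynomial_L2[of c N] le[of N] by (auto simp: s_def[abs_def])
  have B: "0 \<le> B" using le[of 0] by simp
  have "(\<integral>\<^sup>+w. ennreal ((cmod (h w))\<^sup>2) \<partial>?M) = (\<integral>\<^sup>+w. liminf (\<lambda>N. ennreal ((cmod (s N w))\<^sup>2)) \<partial>?M)"
  proof (rule nn_integral_cong)
    fix w assume "w \<in> space ?M"
    then have "(\<lambda>N. s N w) \<longlonglongrightarrow> h w" using sums by (simp add: sums_def s_def)
    then have "(\<lambda>N. ennreal ((cmod (s N w))\<^sup>2)) \<longlonglongrightarrow> ennreal ((cmod (h w))\<^sup>2)"
      by (intro tendsto_ennrealI tendsto_intros)
    then show "ennreal ((cmod (h w))\<^sup>2) = liminf (\<lambda>N. ennreal ((cmod (s N w))\<^sup>2))"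
      by (intro lim_imp_Liminf[symmetric]) auto
  qed
  also have "\<dots> \<le> liminf (\<lambda>N. \<integral>\<^sup>+w. ennreal ((cmod (s N w))\<^sup>2) \<partial>?M)"
    using s(1) by (intro nn_integral_liminf) (auto simp: L2_space_def)
  also have "\<dots> \<le> liminf (\<lambda>N::nat. ennreal (pi * B))"
    using s by (intro Liminf_mono always_eventually allI) (auto simp: nn_integral_L2_norm ennreal_leI)
  also have "\<dots> = ennreal (pi * B)" by (simp add: Liminf_const)
  finally have le': "(\<integral>\<^sup>+w. ennreal ((cmod (h w))\<^sup>2) \<partial>?M) \<le> ennreal (pi * B)" .
  show "h \<in> L2_space ?M" "(L2_norm ?M h)\<^sup>2 \<le> pi * B"
    using L2_spaceI_nn_integral[OF h le'] B by auto
qed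

text \<open>For fixed \<open>z\<close> the terms of the geometric expansion of the kernel,
  multiplied by \<open>f w\<close>, are dominated by \<open>cmod z ^ n * cmod (f w)\<close>. Since
  \<open>cmod z < 1\<close> and \<open>f\<close> is integrable, the series may be integrated term by
  term.\<close>

lemma K1_power_series:
  assumes f: "f \<in> L2_space (lebesgue_on disk)" and z: "z \<in> disk"
  shows "(\<lambda>n. (\<integral>w. f w * cnj w ^ n \<partial>lebesgue_on disk) * z ^ n) sums K1 f z"
proof -
  let ?M = "lebesgue_on disk"
  let ?g = "\<lambda>n w. z ^ n * (f w * cnj w ^ n)"
  have intf: "integrable ?M f" using disk.L2_space_imp_integrable[OF f] .
  have int: "integrable ?M (?g n)" for n
    by (intro integrable_mult_right integrable_mult_cnj_power intf)
  have z1: "cmod z < 1" using z by simp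
  have bound: "cmod (?g n w) \<le> cmod z ^ n * cmod (f w)" if "w \<in> disk" for n w
    using that by (auto simp: norm_mult norm_power intro!: mult_left_mono mult_left_le power_le_one)
  have geo: "summable (\<lambda>n. cmod z ^ n * c)" for c using z1 by (intro summable_mult2 summable_geometric) auto
  have "(\<lambda>n. \<integral>w. ?g n w \<partial>?M) sums (\<integral>w. (\<Sum>n. ?g n w) \<partial>?M)"
  proof (rule sums_integral[OF int])
    show "AE w in ?M. summable (\<lambda>n. cmod (?g n w))"
      by (intro AE_I2 summable_comparison_test'[OF geo]) (use bound in auto)
    show "summable (\<lambda>n. \<integral>w. cmod (?g n w) \<partial>?M)"
    proof (rule summable_comparison_test'[OF geo])
      fix n
      have "(\<integral>w. cmod (?g n w) \<partial>?M) \<le> (\<integral>w. cmod z ^ n * cmod (f w) \<partial>?M)"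
        using int intf bound by (intro integral_mono integrable_norm integrable_mult_right) (auto intro: integrable_mult_cnj_power)
      then show "norm (\<integral>w. cmod (?g n w) \<partial>?M) \<le> cmod z ^ n * (\<integral>w. cmod (f w) \<partial>?M)"
        by (simp add: integrable_mult_cnj_power intf)
    qed
  qed
  moreover have "(\<integral>w. (\<Sum>n. ?g n w) \<partial>?M) = K1 f z"
    unfolding K1_def
  proof (rule Bochner_Integration.integral_cong[OF refl])
    fix w assume "w \<in> space ?M"
    then have "cmod (z * cnj w) \<le> cmod z" by (auto simp: norm_mult intro: mult_left_le)
    then have "cmod (z * cnj w) < 1" using z1 by linarith
    then have "(\<lambda>n. f w * (z * cnj w) ^ n) sums (f w * (1 / (1 - z * cnj w)))"
      by (intro sums_mult geometric_sums)
    then show "(\<Sum>n. ?g n w) = f w / (1 - z * cnj w)"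
      by (simp add: sums_iff power_mult_distrib mult_ac)
  qed
  ultimately show ?thesis by (simp add: mult.commute)
qed

text \<open>The coefficients give no uniform control up to the boundary. The moment is therefore
  computed over balls of radius \<open>r < 1\<close>, where the series is uniformly dominated, and
  \<open>r\<close> then tends to 1 by dominated convergence with majorant
  \<open>cmod (h w * cnj w ^ n)\<close>.\<close>

lemma moment_power_series:
  assumes sums: "\<And>w. w \<in> disk \<Longrightarrow> (\<lambda>n. c n * w ^ n) sums h w"
    and int: "integrable (lebesgue_on disk) h"
  shows "(\<integral>w. h w * cnj w ^ n \<partial>lebesgue_on disk) = c n * of_real (pi / (n + 1))"
proof -
  let ?M = "lebesgue_on disk"
  have ballr: "(\<integral>w. indicator (ball 0 r) w *\<^sub>R (h w * cnj w ^ n) \<partial>?M) = c n * of_real (pi * r ^ (2 * n + 2) / (n + 1))"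
    if r: "0 < r" "r < 1" for r
  proof -
    let ?g = "\<lambda>m w. c m * (indicator (ball 0 r) w *\<^sub>R (w ^ m * cnj w ^ n))"
    have bound: "cmod (?g m w) \<le> cmod (c m * of_real r ^ m)" for m w
      using r norm_monomial_le[of w r m n] by (auto simp: indicator_def norm_mult norm_power intro!: mult_left_mono)
    \<comment> \<open>Convergence at the intermediate radius \<open>R\<close> yields absolute
      convergence at \<open>r\<close>.\<close>
    obtain R where R: "r < R" "R < 1" using r dense by blast
    have "summable (\<lambda>m. c m * of_real R ^ m)" using R r by (intro sums_summable[OF sums]) auto
    then have sm: "summable (\<lambda>m. cmod (c m * of_real r ^ m))"
      by (rule powser_insidea) (use R r in auto)
    have m[measurable]: "?g m \<in> borel_measurable ?M" for m
      by (intro borel_measurable_times borel_measurable_scaleR borel_measurable_disk_indicator_ball borel_measurable_const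
          borel_measurable_disk_continuous continuous_intros)
    have int: "integrable ?M (?g m)" for m
      by (rule disk.integrable_const_bound[OF _ m]) (use bound in auto)
    have "(\<lambda>m. \<integral>w. ?g m w \<partial>?M) sums (\<integral>w. (\<Sum>m. ?g m w) \<partial>?M)"
    proof (rule sums_integral[OF int])
      show "AE w in ?M. summable (\<lambda>m. cmod (?g m w))"
        by (intro AE_I2 summable_comparison_test'[OF sm]) (use bound in auto)
      show "summable (\<lambda>m. \<integral>w. cmod (?g m w) \<partial>?M)"
      proof (rule summable_comparison_test'[OF summable_mult2[OF sm]])
        fix m
        have "(\<integral>w. cmod (?g m w) \<partial>?M) \<le> (\<integral>w. cmod (c m * of_real r ^ m) \<partial>?M)"
          using int bound by (intro integral_mono integrable_norm) auto
        then show "norm (\<integral>w. cmod (?g m w) \<partial>?M) \<le> cmod (c m * of_real r ^ m) * measure ?M disk"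
          by (simp add: mult.commute)
      qed
    qed
    moreover have "(\<integral>w. (\<Sum>m. ?g m w) \<partial>?M) = (\<integral>w. indicator (ball 0 r) w *\<^sub>R (h w * cnj w ^ n) \<partial>?M)"
    proof (rule Bochner_Integration.integral_cong[OF refl])
      fix w assume "w \<in> space ?M"
      then have "(\<lambda>m. c m * w ^ m) sums h w" using sums by simp
      then have "(\<lambda>m. (c m * w ^ m) * (of_real (indicator (ball 0 r) w) * cnj w ^ n)) sums
          (h w * (of_real (indicator (ball 0 r) w) * cnj w ^ n))"
        by (rule sums_mult2)
      then show "(\<Sum>m. ?g m w) = indicator (ball 0 r) w *\<^sub>R (h w * cnj w ^ n)"
        by (simp add: sums_iff scaleR_conv_of_real mult_ac)
    qed
    moreover have "(\<integral>w. ?g m w \<partial>?M) = (if m = n then c n * of_real (pi * r ^ (2 * n + 2) / (n + 1)) else 0)" for m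
      using r by (subst integral_mult_right_zero, subst moment_ball_disk) auto
    ultimately show ?thesis
      using sums_single[of n "\<lambda>_. c n * of_real (pi * r ^ (2 * n + 2) / (n + 1))"] sums_unique2 by auto
  qed
  \<comment> \<open>Any sequence in the open unit interval with limit 1 serves; the shift by 2 keeps
    \<open>r 0\<close> positive, as \<open>ballr\<close> requires.\<close>
  define r where "r k = 1 - 1 / (real k + 2)" for k
  have r: "0 < r k" "r k < 1" for k by (auto simp: r_def field_simps)
  have rlim: "r \<longlonglongrightarrow> 1" unfolding r_def by real_asymp
  have "(\<lambda>k. \<integral>w. indicator (ball 0 (r k)) w *\<^sub>R (h w * cnj w ^ n) \<partial>?M) \<longlonglongrightarrow> (\<integral>w. h w * cnj w ^ n \<partial>?M)"
  proof (rule integral_dominated_convergence[where w="\<lambda>w. cmod (h w * cnj w ^ n)"])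
    have i: "integrable ?M (\<lambda>w. h w * cnj w ^ n)" by (rule integrable_mult_cnj_power[OF int])
    then show m: "(\<lambda>w. h w * cnj w ^ n) \<in> borel_measurable ?M" by simp
    show "integrable ?M (\<lambda>w. cmod (h w * cnj w ^ n))" using i by simp
    show "(\<lambda>w. indicator (ball 0 (r k)) w *\<^sub>R (h w * cnj w ^ n)) \<in> borel_measurable ?M" for k
      by (intro borel_measurable_scaleR borel_measurable_disk_indicator_ball m)
    show "AE w in ?M. (\<lambda>k. indicator (ball 0 (r k)) w *\<^sub>R (h w * cnj w ^ n)) \<longlonglongrightarrow> h w * cnj w ^ n"
    proof (rule AE_I2)
      fix w assume "w \<in> space ?M"
      then have "eventually (\<lambda>k. cmod w < r k) sequentially" using order_tendstoD(1)[OF rlim] by simp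
      then have "eventually (\<lambda>k. indicator (ball 0 (r k)) w *\<^sub>R (h w * cnj w ^ n) = h w * cnj w ^ n) sequentially"
        by eventually_elim auto
      then show "(\<lambda>k. indicator (ball 0 (r k)) w *\<^sub>R (h w * cnj w ^ n)) \<longlonglongrightarrow> h w * cnj w ^ n"
        by (rule tendsto_eventually)
    qed
    show "AE w in ?M. cmod (indicator (ball 0 (r k)) w *\<^sub>R (h w * cnj w ^ n)) \<le> cmod (h w * cnj w ^ n)" for k
      by (intro AE_I2) (auto simp: indicator_def)
  qed
  moreover have "(\<lambda>k. c n * of_real (pi * r k ^ (2 * n + 2) / (n + 1))) \<longlonglongrightarrow> c n * of_real (pi * 1 ^ (2 * n + 2) / (n + 1))"
    by (intro tendsto_intros rlim) auto
  ultimately show ?thesis unfolding ballr[OF r] by (auto dest: LIMSEQ_unique)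
qed

subsection \<open>The operator and the Dirichlet space\<close>

lemma dirichlet_norm_power2:
  "(dirichlet_norm f)\<^sup>2 = (cmod (f 0))\<^sup>2 + (L2_norm (lebesgue_on disk) (deriv f))\<^sup>2 / pi"
  unfolding dirichlet_norm_def L2_norm_power2 by (subst real_sqrt_pow2) auto

lemma deriv_in_L2_space:
  assumes "f \<in> dirichlet_space"
  shows "deriv f \<in> L2_space (lebesgue_on disk)"
  using assms unfolding dirichlet_space_def L2_space_def
  by (auto intro!: borel_measurable_disk_continuous holomorphic_on_imp_continuous_on holomorphic_deriv)

lemma deriv_power_series:
  assumes "\<And>w. w \<in> disk \<Longrightarrow> (\<lambda>n. a n * w ^ n) sums f w" and "w \<in> disk"
  shows "(\<lambda>n. diffs a n * w ^ n) sums deriv f w"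
proof (rule termdiffs_sums_strong[where K=1 and f=f])
  have "f holomorphic_on disk" using assms(1) by (intro power_series_holomorphic[where a=a]) auto
  then show "(f has_field_derivative deriv f w) (at w)"
    using assms(2) by (intro holomorphic_derivI[where S=disk]) auto
qed (use assms in auto)

text \<open>Bessel's inequality is applied twice, to the value at the origin and to the derivative;
  each contributes \<open>pi\<close> to the constant.\<close>

lemma K1_dirichlet:
  assumes f: "f \<in> L2_space (lebesgue_on disk)"
  shows K1_in_dirichlet_space: "K1 f \<in> dirichlet_space"
    and K1_dirichlet_norm: "(dirichlet_norm (K1 f))\<^sup>2 \<le> 2 * pi * (L2_norm (lebesgue_on disk) f)\<^sup>2"
proof -
  let ?M = "lebesgue_on disk"
  define a where "a n = (\<integral>w. f w * cnj w ^ n \<partial>?M)" for n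
  have bessel: "(\<Sum>n<N. real (n + 1) * (cmod (a n))\<^sup>2) \<le> pi * (L2_norm ?M f)\<^sup>2" for N
    unfolding a_def by (rule bessel_monomials[OF f])
  have sums: "(\<lambda>n. a n * z ^ n) sums K1 f z" if "z \<in> disk" for z
    unfolding a_def by (rule K1_power_series[OF f that])
  have holo: "K1 f holomorphic_on disk" using sums by (intro power_series_holomorphic[where a=a]) auto
  have le: "(\<Sum>n<N. (cmod (diffs a n))\<^sup>2 / real (n + 1)) \<le> pi * (L2_norm ?M f)\<^sup>2" for N
  proof -
    \<comment> \<open>As \<open>diffs a n\<close> is \<open>a (Suc n)\<close> times
      \<open>n + 1\<close>, the weight left after division is \<open>n + 1\<close>. It is enlarged
      to \<open>n + 2\<close> to match the shifted Bessel sum.\<close>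
    have "(\<Sum>n<N. (cmod (diffs a n))\<^sup>2 / real (n + 1)) \<le> (\<Sum>n<N. real (Suc n + 1) * (cmod (a (Suc n)))\<^sup>2)"
    proof (rule sum_mono)
      fix n
      have "cmod (diffs a n) = real (n + 1) * cmod (a (Suc n))"
        unfolding diffs_def norm_mult norm_of_nat by simp
      then have "(cmod (diffs a n))\<^sup>2 / real (n + 1) = real (n + 1) * (cmod (a (Suc n)))\<^sup>2"
        by (simp only: power2_mult_divide)
      then show "(cmod (diffs a n))\<^sup>2 / real (n + 1) \<le> real (Suc n + 1) * (cmod (a (Suc n)))\<^sup>2"
        by (simp add: mult_right_mono)
    qed
    also have "\<dots> \<le> (\<Sum>n<Suc N. real (n + 1) * (cmod (a n))\<^sup>2)"
      unfolding sum.lessThan_Suc_shift by simp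
    finally show ?thesis using bessel[of "Suc N"] by linarith
  qed
  note d = power_series_L2[OF deriv_power_series[OF sums] le, simplified]
  show "K1 f \<in> dirichlet_space"
    using d(1) holo by (simp add: dirichlet_space_def L2_space_def)
  \<comment> \<open>At \<open>z = 0\<close> the kernel is 1, so \<open>K1 f 0\<close> is
    \<open>a 0\<close>, the only coefficient in the Bessel sum for \<open>N = 1\<close>.\<close>
  have "(cmod (K1 f 0))\<^sup>2 \<le> pi * (L2_norm ?M f)\<^sup>2"
    using bessel[of 1] by (simp add: a_def K1_def)
  moreover have "(L2_norm ?M (deriv (K1 f)))\<^sup>2 / pi \<le> pi * (L2_norm ?M f)\<^sup>2"
    using d(2) by (simp add: field_simps)
  ultimately show "(dirichlet_norm (K1 f))\<^sup>2 \<le> 2 * pi * (L2_norm ?M f)\<^sup>2"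
    unfolding dirichlet_norm_power2 by linarith
qed

lemma moment_cancel: "of_nat (Suc n) * x * complex_of_real (pi / real (n + 1)) = of_real pi * x"
proof -
  have "complex_of_real (pi / real (n + 1)) = of_real pi / of_nat (Suc n)"
    by (simp add: add.commute)
  then show ?thesis by (simp del: of_nat_Suc)
qed

text \<open>The preimage is \<open>(z g)' / \<pi>\<close>: its \<open>n\<close>-th coefficient \<open>(n + 1) a\<^sub>n / \<pi>\<close> cancels the squared norm
  \<open>\<pi> / (n + 1)\<close> of the monomial.\<close>

lemma dirichlet_K1_preimage:
  assumes g: "g \<in> dirichlet_space"
  obtains f where "f \<in> L2_space (lebesgue_on disk)"
    and "(L2_norm (lebesgue_on disk) f)\<^sup>2 \<le> 2 / pi * (dirichlet_norm g)\<^sup>2"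
    and "\<And>z. z \<in> disk \<Longrightarrow> K1 f z = g z"
proof
  let ?M = "lebesgue_on disk"
  let ?f = "\<lambda>w. deriv (\<lambda>w. w * g w) w / pi"
  define a where "a n = (deriv ^^ n) g 0 / fact n" for n
  \<comment> \<open>Taylor coefficients of \<open>w * g w\<close>: those of \<open>g\<close> shifted
    by one, with constant term 0. Differentiating and dividing by \<open>pi\<close> gives
    \<open>c\<close>.\<close>
  define b where "b n = (case n of 0 \<Rightarrow> 0 | Suc k \<Rightarrow> a k)" for n
  define c where "c n = of_nat (Suc n) * a n / pi" for n
  have a0: "a 0 = g 0" by (simp add: a_def)
  have sums: "(\<lambda>n. a n * w ^ n) sums g w" if "w \<in> disk" for w
    using holomorphic_power_series[of g 0 1 w] g that by (simp add: a_def dirichlet_space_def)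
  have "(\<lambda>n. b n * w ^ n) sums (w * g w)" if "w \<in> disk" for w
  proof -
    have "(\<lambda>n. b (Suc n) * w ^ Suc n) sums (w * g w)"
      using sums_mult[OF sums[OF that], of w] by (simp add: b_def mult_ac)
    then show ?thesis using sums_Suc[of "\<lambda>n. b n * w ^ n" "w * g w"] by (simp add: b_def)
  qed
  from deriv_power_series[of b, OF this]
  have fsums: "(\<lambda>n. c n * w ^ n) sums ?f w" if "w \<in> disk" for w
    using that sums_divide[of _ _ "complex_of_real pi"] by (fastforce simp: diffs_def b_def c_def)
  \<comment> \<open>The moments of \<open>deriv g\<close> return its coefficients, so that Bessel's
    inequality bounds them by the Dirichlet norm of \<open>g\<close>.\<close>
  have gm: "(\<integral>w. deriv g w * cnj w ^ n \<partial>?M) = pi * a (Suc n)" for n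
    using moment_power_series[OF deriv_power_series[OF sums] disk.L2_space_imp_integrable[OF deriv_in_L2_space[OF g]], of n]
    unfolding diffs_def moment_cancel by simp
  have "pi * (\<Sum>n<N. real (n + 1) * (cmod (a (Suc n)))\<^sup>2) \<le> (L2_norm ?M (deriv g))\<^sup>2" for N
  proof -
    have "pi * (pi * (\<Sum>n<N. real (n + 1) * (cmod (a (Suc n)))\<^sup>2)) \<le> pi * (L2_norm ?M (deriv g))\<^sup>2"
      using bessel_monomials[OF deriv_in_L2_space[OF g], of N] unfolding gm
      by (simp add: norm_mult sum_distrib_left power2_eq_square mult_ac)
    then show ?thesis by simp
  qed
  then have shifted: "(\<Sum>n<N. real (n + 1) * (cmod (a (Suc n)))\<^sup>2) \<le> (L2_norm ?M (deriv g))\<^sup>2 / pi" for N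
    by (simp add: field_simps)
  have le: "(\<Sum>n<N. (cmod (c n))\<^sup>2 / real (n + 1)) \<le> 2 / pi\<^sup>2 * (dirichlet_norm g)\<^sup>2" for N
  proof -
    have "(cmod (c n))\<^sup>2 / real (n + 1) = real (n + 1) * (cmod (a n))\<^sup>2 / pi\<^sup>2" for n
    proof -
      have *: "cmod (c n) = real (n + 1) * (cmod (a n) / pi)"
        unfolding c_def norm_mult norm_divide norm_of_nat by simp
      show ?thesis unfolding * power2_mult_divide by (simp add: power_divide)
    qed
    then have "(\<Sum>n<N. (cmod (c n))\<^sup>2 / real (n + 1)) = (\<Sum>n<N. real (n + 1) * (cmod (a n))\<^sup>2) / pi\<^sup>2"
      by (simp add: sum_divide_distrib)
    moreover have "(\<Sum>n<N. real (n + 1) * (cmod (a n))\<^sup>2) \<le> 2 * (dirichlet_norm g)\<^sup>2"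
    proof -
      have "(\<Sum>n<N. real (n + 1) * (cmod (a n))\<^sup>2) \<le> (\<Sum>n<Suc N. real (n + 1) * (cmod (a n))\<^sup>2)" by simp
      also have "\<dots> = (cmod (a 0))\<^sup>2 + (\<Sum>n<N. real (Suc n + 1) * (cmod (a (Suc n)))\<^sup>2)"
        unfolding sum.lessThan_Suc_shift by simp
      \<comment> \<open>After the index shift the weight is \<open>n + 2\<close>, at most twice
        \<open>n + 1\<close>; this is the source of the factor 2.\<close>
      also have "(\<Sum>n<N. real (Suc n + 1) * (cmod (a (Suc n)))\<^sup>2) \<le> (\<Sum>n<N. 2 * (real (n + 1) * (cmod (a (Suc n)))\<^sup>2))"
        by (intro sum_mono) (auto simp: algebra_simps)
      also have "\<dots> = 2 * (\<Sum>n<N. real (n + 1) * (cmod (a (Suc n)))\<^sup>2)" by (rule sum_distrib_left[symmetric])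
      finally have "(\<Sum>n<N. real (n + 1) * (cmod (a n))\<^sup>2)
          \<le> (cmod (g 0))\<^sup>2 + 2 * (\<Sum>n<N. real (n + 1) * (cmod (a (Suc n)))\<^sup>2)" by (simp add: a0)
      moreover have "s \<le> 2 * (q + l)" if "s \<le> q + 2 * t" "t \<le> l" "0 \<le> q" for s q t l :: real
        using that by simp
      ultimately show ?thesis
        unfolding dirichlet_norm_power2 using shifted[of N] zero_le_power2 by blast
    qed
    ultimately show ?thesis by (simp add: divide_right_mono)
  qed
  show f: "?f \<in> L2_space ?M" by (rule power_series_in_L2_space[OF fsums le])
  show "(L2_norm ?M ?f)\<^sup>2 \<le> 2 / pi * (dirichlet_norm g)\<^sup>2"
    using power_series_L2_norm[OF fsums le] by (simp add: power2_eq_square)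
  show "K1 ?f z = g z" if z: "z \<in> disk" for z
  proof -
    have "(\<integral>w. ?f w * cnj w ^ n \<partial>?M) = a n" for n
      using moment_power_series[OF fsums disk.L2_space_imp_integrable[OF f], of n]
      unfolding c_def times_divide_eq_right[symmetric] moment_cancel by simp
    then have "(\<lambda>n. a n * z ^ n) sums K1 ?f z"
      using K1_power_series[OF f z] by simp
    then show ?thesis using sums[OF z] sums_unique2 by blast
  qed
qed

text \<open>The kernel is bounded by \<open>1 / (1 - cmod z)\<close> on the disk. Integrability is
  what makes \<open>K1\<close> additive, since the Bochner integral of a non-integrable function is
  0 by convention.\<close>

lemma K1_integrable:
  assumes f: "integrable (lebesgue_on disk) f" and z: "z \<in> disk"
  shows "integrable (lebesgue_on disk) (\<lambda>w. f w / (1 - z * cnj w))"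
proof -
  have lower: "1 - cmod z \<le> cmod (1 - z * cnj w)" if "w \<in> disk" for w
  proof -
    have "cmod (z * cnj w) \<le> cmod z" using that by (auto simp: norm_mult intro: mult_left_le)
    then show ?thesis using norm_triangle_ineq2[of 1 "z * cnj w"] by simp
  qed
  have "integrable (lebesgue_on disk) (\<lambda>w. f w * (1 / (1 - z * cnj w)))"
  proof (rule integrable_mult_bounded[OF f])
    have ne: "1 - z * cnj w \<noteq> 0" if "w \<in> disk" for w using lower[OF that] z by auto
    show "(\<lambda>w. 1 / (1 - z * cnj w)) \<in> borel_measurable (lebesgue_on disk)"
      using ne by (intro borel_measurable_disk_continuous continuous_intros) auto
    show "cmod (1 / (1 - z * cnj w)) \<le> 1 / (1 - cmod z)" if "w \<in> space (lebesgue_on disk)" for w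
      using that z lower[of w] by (auto simp: norm_divide intro!: divide_left_mono mult_pos_pos)
  qed
  then show ?thesis by simp
qed

section \<open>Equivalence of the Carleson condition and the boundedness of the operator\<close>

theorem lemma6:
  fixes \<mu> :: "complex measure"
  assumes "sets \<mu> = sets (restrict_space borel disk)"
  shows "dirichlet_carleson \<mu> \<longleftrightarrow> bounded_L2_operator (lebesgue_on disk) \<mu> K1"
proof
  let ?M = "lebesgue_on disk"
  have space: "space \<mu> = disk" using sets_eq_imp_space_eq[OF assms] by (simp add: space_restrict_space)
  assume "dirichlet_carleson \<mu>"
  then obtain C where C: "0 \<le> C" and carleson:
    "\<And>f. f \<in> dirichlet_space \<Longrightarrow> (\<integral>\<^sup>+z. ennreal ((cmod (f z))\<^sup>2) \<partial>\<mu>) \<le> ennreal (C * (dirichlet_norm f)\<^sup>2)"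
    unfolding dirichlet_carleson_def by blast
  \<comment> \<open>The operator factors through the Dirichlet space: \<open>K1_dirichlet\<close>
    bounds the first map, and the Carleson condition bounds the embedding into the space over
    \<mu>.\<close>
  have K1: "K1 f \<in> L2_space \<mu>" "(L2_norm \<mu> (K1 f))\<^sup>2 \<le> C * (2 * pi * (L2_norm ?M f)\<^sup>2)"
    if f: "f \<in> L2_space ?M" for f
  proof -
    have "K1 f \<in> borel_measurable (restrict_space borel disk)"
      using K1_in_dirichlet_space[OF f]
      by (intro borel_measurable_continuous_on_restrict holomorphic_on_imp_continuous_on) (simp add: dirichlet_space_def)
    then have m: "K1 f \<in> borel_measurable \<mu>" using measurable_cong_sets[OF assms refl] by blast
    have "(\<integral>\<^sup>+z. ennreal ((cmod (K1 f z))\<^sup>2) \<partial>\<mu>) \<le> ennreal (C * (dirichlet_norm (K1 f))\<^sup>2)"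
      by (rule carleson[OF K1_in_dirichlet_space[OF f]])
    also have "\<dots> \<le> ennreal (C * (2 * pi * (L2_norm ?M f)\<^sup>2))"
      using C K1_dirichlet_norm[OF f] by (intro ennreal_leI mult_left_mono)
    finally show "K1 f \<in> L2_space \<mu>" "(L2_norm \<mu> (K1 f))\<^sup>2 \<le> C * (2 * pi * (L2_norm ?M f)\<^sup>2)"
      using C by (auto intro!: L2_spaceI_nn_integral[OF m])
  qed
  show "bounded_L2_operator ?M \<mu> K1"
    unfolding bounded_L2_operator_def
  proof (intro conjI ballI allI)
    fix f assume f: "f \<in> L2_space ?M"
    show "K1 f \<in> L2_space \<mu>" by (rule K1(1)[OF f])
    note int = K1_integrable[OF disk.L2_space_imp_integrable]
    show "AE z in \<mu>. K1 (\<lambda>w. f w + g w) z = K1 f z + K1 g z" if g: "g \<in> L2_space ?M" for g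
      using int[OF f] int[OF g] by (intro AE_I2) (simp add: K1_def space add_divide_distrib)
    show "AE z in \<mu>. K1 (\<lambda>w. c * f w) z = c * K1 f z" for c
      by (intro AE_I2) (simp add: K1_def flip: times_divide_eq_right)
  next
    show "\<exists>D\<ge>0. \<forall>f\<in>L2_space ?M. L2_norm \<mu> (K1 f) \<le> D * L2_norm ?M f"
    proof (intro exI[of _ "sqrt (C * (2 * pi))"] conjI ballI)
      fix f assume f: "f \<in> L2_space ?M"
      have "(L2_norm \<mu> (K1 f))\<^sup>2 \<le> (sqrt (C * (2 * pi)) * L2_norm ?M f)\<^sup>2"
        using K1(2)[OF f] C by (simp add: power_mult_distrib mult_ac)
      then show "L2_norm \<mu> (K1 f) \<le> sqrt (C * (2 * pi)) * L2_norm ?M f"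
        by (rule power2_le_imp_le) (use C in \<open>simp add: L2_norm_nonneg\<close>)
    qed (use C in simp)
  qed
next
  let ?M = "lebesgue_on disk"
  have space: "space \<mu> = disk" using sets_eq_imp_space_eq[OF assms] by (simp add: space_restrict_space)
  assume "bounded_L2_operator ?M \<mu> K1"
  then obtain C where C: "0 \<le> C" "\<And>f. f \<in> L2_space ?M \<Longrightarrow> L2_norm \<mu> (K1 f) \<le> C * L2_norm ?M f"
    and K1: "\<And>f. f \<in> L2_space ?M \<Longrightarrow> K1 f \<in> L2_space \<mu>"
    unfolding bounded_L2_operator_def by blast
  show "dirichlet_carleson \<mu>"
    unfolding dirichlet_carleson_def
  \<comment> \<open>The square of the operator bound times the constant for the preimage under
    \<open>K1\<close>.\<close>
  proof (intro exI[of _ "C\<^sup>2 * (2 / pi)"] conjI ballI)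
    fix g assume "g \<in> dirichlet_space"
    then obtain f where f: "f \<in> L2_space ?M" "(L2_norm ?M f)\<^sup>2 \<le> 2 / pi * (dirichlet_norm g)\<^sup>2"
      and eq: "\<And>z. z \<in> disk \<Longrightarrow> K1 f z = g z"
      using dirichlet_K1_preimage by blast
    \<comment> \<open>Agreement at every point of the disk justifies the replacement; agreement
      almost everywhere for area would not, as \<mu> may charge Lebesgue null sets.\<close>
    have "(\<integral>\<^sup>+z. ennreal ((cmod (g z))\<^sup>2) \<partial>\<mu>) = (\<integral>\<^sup>+z. ennreal ((cmod (K1 f z))\<^sup>2) \<partial>\<mu>)"
      by (intro nn_integral_cong) (simp add: space eq)
    also have "\<dots> = ennreal ((L2_norm \<mu> (K1 f))\<^sup>2)"
      by (rule nn_integral_L2_norm[OF K1[OF f(1)]])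
    also have "\<dots> \<le> ennreal (C\<^sup>2 * (2 / pi) * (dirichlet_norm g)\<^sup>2)"
    proof (rule ennreal_leI)
      have "(L2_norm \<mu> (K1 f))\<^sup>2 \<le> C\<^sup>2 * (L2_norm ?M f)\<^sup>2"
        using power_mono[OF C(2)[OF f(1)] L2_norm_nonneg, of 2] by (simp add: power_mult_distrib)
      also have "\<dots> \<le> C\<^sup>2 * (2 / pi * (dirichlet_norm g)\<^sup>2)"
        by (intro mult_left_mono f(2)) simp
      finally show "(L2_norm \<mu> (K1 f))\<^sup>2 \<le> C\<^sup>2 * (2 / pi) * (dirichlet_norm g)\<^sup>2" by (simp add: mult.assoc)
    qed
    finally show "(\<integral>\<^sup>+z. ennreal ((cmod (g z))\<^sup>2) \<partial>\<mu>) \<le> ennreal (C\<^sup>2 * (2 / pi) * (dirichlet_norm g)\<^sup>2)" .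
  qed simp
qed

end
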